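(* Let $(\mathcal{G},p)$ be a local-relative-measurement-based network in $\mathbb{R}^3$ with anchor nodes $\mathcal{V}_a$ and free nodes $\mathcal{V}_f$, and assume: no two nodes are collocated; each anchor node has at least two neighboring anchor nodes; each free node has at least four neighboring nodes; and, when the measurements are local relative bearings or angles, each free node and its neighbors are non-colinear. Then $(\mathcal{G},p)$ is localizable if and only if every angle-displacement infinitesimal motion involves at least one anchor node; that is, for every nonzero angle-displacement infinitesimal motion $\delta p=[\delta p_a^T,\delta p_f^T]^T\in\mathrm{Null}(D)$ one has $\delta p_a\neq\mathbf{0}$.
   Context: $\mathcal{G}=(\mathcal{V},\mathcal{E})$ is an undirected graph with $\mathcal{V}=\{1,\dots,n\}$, and $p=(p_1^T,\dots,p_n^T)^T\in\mathbb{R}^{3n}$. Anchor nodes $\mathcal{V}_a=\{1,\dots,n_a\}$ have known positions $p_a=(p_1^T,\dots,p_{n_a}^T)^T$; free nodes $\mathcal{V}_f=\{n_a+1,\dots,n\}$ have unknown positions $p_f=(p_{n_a+1}^T,\dots,p_n^T)^T$. For $x\in\mathbb{R}^{3n}$ write $e_{ij}(x)=x_j-x_i$. Displacement constraints. $\mathcal{X}_{\mathcal{G}}$ is the set of 5-tuples for which displacement constraints are constructed from the local relative measurements (all of one type: local relative position, distance, local relative bearing, angle, or ratio-of-distance). It consists of 5-tuples $(i,j,k,h,l)$ with $(i,j),(i,k),(i,h),(i,l)\in\mathcal{E}$, $j<k<h<l$ (all such tuples for local relative position measurements; in general a subset). Each tuple comes with a fixed nonzero vector $(\mu_{ij},\mu_{ik},\mu_{ih},\mu_{il})\in\mathbb{R}^4$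 (obtained from the measurements) with $\mu_{ij}e_{ij}(p)+\mu_{ik}e_{ik}(p)+\mu_{ih}e_{ih}(p)+\mu_{il}e_{il}(p)=\mathbf{0}$. Angle constraints (only among anchors). $\Upsilon_{\mathcal{G}}$ is the set of triples $(i,j,k)$ of anchor nodes with $i<j<k$ and $(i,j),(i,k),(j,k)\in\mathcal{E}$. With $a=e_{ik}(p)^Te_{ij}(p)$, $b=e_{ki}(p)^Te_{kj}(p)$, put $(w_{ik},w_{ki})=(1/a,-1/b)$ if $a,b\neq0$; $(1,0)$ if $a=0,b\ne0$; $(0,1)$ if $a\neq0,b=0$; $(1,1)$ if $a=b=0$; so $w_{ik}e_{ik}(p)^Te_{ij}(p)+w_{ki}e_{ki}(p)^Te_{kj}(p)=0$. With all coefficients held fixed, the angle-displacement function $f(x)$ stacks the scalars $w_{ik}e_{ik}(x)^Te_{ij}(x)+w_{ki}e_{ki}(x)^Te_{kj}(x)$ over $\Upsilon_{\mathcal{G}}$ and the vectors $\mu_{ij}e_{ij}(x)+\mu_{ik}e_{ik}(x)+\mu_{ih}e_{ih}(x)+\mu_{il}e_{il}(x)$ over $\mathcal{X}_{\mathcal{G}}$. The rigidity matrix is $R(p)=\partial f(x)/\partial x|_{x=p}$, and the angle-displacement information matrix is $D=R(p)^TR(p)$. An angle-displacement infinitesimal motion is a vector $\delta p\in\mathbb{R}^{3n}$ with $R(p)\delta p=0$ (equivalently $D\,\delta p=0$); $\delta p_a\in\mathbb{R}^{3n_a}$ and $\delta p_f$ are its anchor and free-node components. Localizability. $(\mathcal{G},p)$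 is localizable if $\hat p=p$ is the unique $\hat p\in\mathbb{R}^{3n}$ with $\hat p_i=p_i$ for all $i\in\mathcal{V}_a$ and $\mu_{ij}e_{ij}(\hat p)+\mu_{ik}e_{ik}(\hat p)+\mu_{ih}e_{ih}(\hat p)+\mu_{il}e_{il}(\hat p)=\mathbf{0}$ for all $(i,j,k,h,l)\in\mathcal{X}_{\mathcal{G}}$. *)

theory Defs
  imports "HOL-Analysis.Analysis" "Jordan_Normal_Form.Matrix_Kernel"
begin

unbundle no vec_syntax

datatype measurement_type =
  Relative_Position | Distance | Relative_Bearing | Angle | Ratio_Of_Distance

type_synonym tuple5 = "nat \<times> nat \<times> nat \<times> nat \<times> nat"

text \<open>
  Nodes are the numbers \<open>1, \<dots>, num_nodes\<close>, of which \<open>1, \<dots>, num_anchors\<close> are the anchors.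
  A configuration in \<open>\<real>\<^sup>3\<^sup>n\<close> is a vector of dimension \<open>3 n\<close>. For a tuple \<open>t = (i, j, k, h, l)\<close>,
  \<open>disp_coeffs N t\<close> is the coefficient vector \<open>(\<mu>\<^sub>i\<^sub>j, \<mu>\<^sub>i\<^sub>k, \<mu>\<^sub>i\<^sub>h, \<mu>\<^sub>i\<^sub>l)\<close> attached to that tuple;
  its values outside \<open>disp_tuples N\<close> are irrelevant.
\<close>

record network =
  num_nodes :: nat
  num_anchors :: nat
  edges :: "(nat \<times> nat) set"
  position :: "real Matrix.vec"
  measurement :: measurement_type
  disp_tuples :: "tuple5 set"
  disp_coeffs :: "tuple5 \<Rightarrow> real \<times> real \<times> real \<times> real"

definition nodes :: "network \<Rightarrow> nat set" where
  "nodes N = {1..num_nodes N}"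

definition anchors :: "network \<Rightarrow> nat set" where
  "anchors N = {1..num_anchors N}"

definition free_nodes :: "network \<Rightarrow> nat set" where
  "free_nodes N = {num_anchors N + 1..num_nodes N}"

definition neighbors :: "network \<Rightarrow> nat \<Rightarrow> nat set" where
  "neighbors N i = {j. (i, j) \<in> edges N}"

text \<open>Nodes are counted from 1, but vector entries from 0.\<close>

definition node_pos :: "real Matrix.vec \<Rightarrow> nat \<Rightarrow> real ^ 3" where
  "node_pos x i = vector [x $ (3 * (i - 1)), x $ (3 * (i - 1) + 1), x $ (3 * (i - 1) + 2)]"

definition displacement :: "real Matrix.vec \<Rightarrow> nat \<Rightarrow> nat \<Rightarrow> real ^ 3" where
  "displacement x i j = node_pos x j - node_pos x i"

definition candidate_tuples :: "network \<Rightarrow> tuple5 set" where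
  "candidate_tuples N = {(i, j, k, h, l).
     (i, j) \<in> edges N \<and> (i, k) \<in> edges N \<and> (i, h) \<in> edges N \<and> (i, l) \<in> edges N \<and>
     j < k \<and> k < h \<and> h < l}"

definition disp_constraint :: "network \<Rightarrow> real Matrix.vec \<Rightarrow> tuple5 \<Rightarrow> real ^ 3" where
  "disp_constraint N x = (\<lambda>(i, j, k, h, l).
     case disp_coeffs N (i, j, k, h, l) of (\<mu>ij, \<mu>ik, \<mu>ih, \<mu>il) \<Rightarrow>
       \<mu>ij *\<^sub>R displacement x i j + \<mu>ik *\<^sub>R displacement x i k +
       \<mu>ih *\<^sub>R displacement x i h + \<mu>il *\<^sub>R displacement x i l)"

locale measurement_network =
  fixes N :: network
  assumes anchors_le: "num_anchors N \<le> num_nodes N"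
    and edges_subset: "edges N \<subseteq> nodes N \<times> nodes N"
    and edges_sym: "sym (edges N)"
    and edges_irrefl: "irrefl (edges N)"
    and position_dim: "position N \<in> carrier_vec (3 * num_nodes N)"
    and disp_tuples_subset: "disp_tuples N \<subseteq> candidate_tuples N"
    and disp_tuples_relative_position:
      "measurement N = Relative_Position \<Longrightarrow> disp_tuples N = candidate_tuples N"
    and disp_coeffs_nonzero: "t \<in> disp_tuples N \<Longrightarrow> disp_coeffs N t \<noteq> (0, 0, 0, 0)"
    and disp_constraint_position: "t \<in> disp_tuples N \<Longrightarrow> disp_constraint N (position N) t = 0"

definition angle_triples :: "network \<Rightarrow> (nat \<times> nat \<times> nat) set" where
  "angle_triples N = {(i, j, k).
     i \<in> anchors N \<and> j \<in> anchors N \<and> k \<in> anchors N \<and> i < j \<and> j < k \<and>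
     (i, j) \<in> edges N \<and> (i, k) \<in> edges N \<and> (j, k) \<in> edges N}"

text \<open>The pair \<open>(w\<^sub>i\<^sub>k, w\<^sub>k\<^sub>i)\<close> of the triple \<open>(i, j, k)\<close>.\<close>

definition angle_weights :: "network \<Rightarrow> nat \<times> nat \<times> nat \<Rightarrow> real \<times> real" where
  "angle_weights N = (\<lambda>(i, j, k).
     let p = position N;
         a = inner (displacement p i k) (displacement p i j);
         b = inner (displacement p k i) (displacement p k j)
     in if a \<noteq> 0 \<and> b \<noteq> 0 then (1 / a, - 1 / b)
        else if a = 0 \<and> b \<noteq> 0 then (1, 0)
        else if a \<noteq> 0 \<and> b = 0 then (0, 1)
        else (1, 1))"

definition angle_constraint :: "network \<Rightarrow> real Matrix.vec \<Rightarrow> nat \<times> nat \<times> nat \<Rightarrow> real" where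
  "angle_constraint N x = (\<lambda>(i, j, k).
     case angle_weights N (i, j, k) of (wik, wki) \<Rightarrow>
       wik * inner (displacement x i k) (displacement x i j) +
       wki * inner (displacement x k i) (displacement x k j))"

text \<open>The constraints are stacked in the lexicographic order of their index tuples.\<close>

definition node_list :: "network \<Rightarrow> nat list" where
  "node_list N = [1..<num_nodes N + 1]"

definition angle_list :: "network \<Rightarrow> (nat \<times> nat \<times> nat) list" where
  "angle_list N = (let V = node_list N in
     filter (\<lambda>t. t \<in> angle_triples N) (List.product V (List.product V V)))"

definition disp_list :: "network \<Rightarrow> tuple5 list" where
  "disp_list N = (let V = node_list N in
     filter (\<lambda>t. t \<in> disp_tuples N)
       (List.product V (List.product V (List.product V (List.product V V)))))"

definition angle_displacement_function :: "network \<Rightarrow> real Matrix.vec \<Rightarrow> real Matrix.vec" where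
  "angle_displacement_function N x = vec_of_list
     (map (angle_constraint N x) (angle_list N) @
      concat (map (\<lambda>t. map (vec_nth (disp_constraint N x t)) [1, 2, 3]) (disp_list N)))"

definition jacobian :: "(real Matrix.vec \<Rightarrow> real Matrix.vec) \<Rightarrow> real Matrix.vec \<Rightarrow> real Matrix.mat" where
  "jacobian f x = Matrix.mat (dim_vec (f x)) (dim_vec x)
     (\<lambda>(r, c). deriv (\<lambda>s. f (x + s \<cdot>\<^sub>v unit_vec (dim_vec x) c) $ r) 0)"

definition rigidity_matrix :: "network \<Rightarrow> real Matrix.mat" where
  "rigidity_matrix N = jacobian (angle_displacement_function N) (position N)"

definition information_matrix :: "network \<Rightarrow> real Matrix.mat" where
  "information_matrix N = transpose_mat (rigidity_matrix N) * rigidity_matrix N"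

definition infinitesimal_motion :: "network \<Rightarrow> real Matrix.vec \<Rightarrow> bool" where
  "infinitesimal_motion N \<delta>p \<longleftrightarrow> \<delta>p \<in> mat_kernel (rigidity_matrix N)"

lemma infinitesimal_motion_iff_information_matrix:
  "infinitesimal_motion N \<delta>p \<longleftrightarrow> \<delta>p \<in> mat_kernel (information_matrix N)"
proof -
  define R where "R = rigidity_matrix N"
  define v where "v = R *\<^sub>v \<delta>p"
  have R: "R \<in> carrier_mat (dim_row R) (dim_col R)" by simp
  have D: "transpose_mat R * R *\<^sub>v \<delta>p = transpose_mat R *\<^sub>v v" if "\<delta>p \<in> carrier_vec (dim_col R)"
    unfolding v_def using that by (intro assoc_mult_mat_vec[of _ _ "dim_row R"]) auto
  have v: "v \<in> carrier_vec (dim_row R)" unfolding v_def by (rule carrier_vecI) simp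
  have v_0: "v = 0\<^sub>v (dim_row R)"
    if \<delta>p: "\<delta>p \<in> carrier_vec (dim_col R)" and 0: "transpose_mat R *\<^sub>v v = 0\<^sub>v (dim_col R)"
  proof -
    have "scalar_prod v v = scalar_prod (transpose_mat R *\<^sub>v v) \<delta>p"
      using transpose_vec_mult_scalar[OF R \<delta>p v] by (simp only: v_def)
    also have "\<dots> = 0" using \<delta>p by (simp only: 0 scalar_prod_left_zero)
    finally have "(\<Sum>i = 0..<dim_row R. (v $ i)\<^sup>2) = 0"
      by (simp only: scalar_prod_def power2_eq_square carrier_vecD[OF v])
    then have "\<forall>i<dim_row R. v $ i = 0"
      by (subst (asm) sum_nonneg_eq_0_iff) auto
    then show ?thesis using carrier_vecD[OF v] by (intro eq_vecI) simp_all
  qed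
  have R_0: "transpose_mat R *\<^sub>v 0\<^sub>v (dim_row R) = 0\<^sub>v (dim_col R)"
    by (intro eq_vecI) simp_all
  have "\<delta>p \<in> mat_kernel R \<longleftrightarrow> \<delta>p \<in> carrier_vec (dim_col R) \<and> v = 0\<^sub>v (dim_row R)"
    by (simp only: mat_kernel_def v_def mem_Collect_eq)
  also have "\<dots> \<longleftrightarrow> \<delta>p \<in> carrier_vec (dim_col R) \<and> transpose_mat R *\<^sub>v v = 0\<^sub>v (dim_col R)"
    using v_0 R_0 by metis
  also have "\<dots> \<longleftrightarrow> \<delta>p \<in> mat_kernel (transpose_mat R * R)"
    using D by (simp add: mat_kernel_def cong: conj_cong)
  finally have "\<delta>p \<in> mat_kernel R \<longleftrightarrow> \<delta>p \<in> mat_kernel (transpose_mat R * R)" .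
  then show ?thesis
    by (simp only: infinitesimal_motion_def information_matrix_def R_def)
qed

definition localizable :: "network \<Rightarrow> bool" where
  "localizable N \<longleftrightarrow>
     {q \<in> carrier_vec (3 * num_nodes N).
        (\<forall>i \<in> anchors N. node_pos q i = node_pos (position N) i) \<and>
        (\<forall>t \<in> disp_tuples N. disp_constraint N q t = 0)} = {position N}"

end

theory Submission
  imports Defs
begin

text \<open>
  The displacement constraints are linear, so \<open>N\<close> is localizable iff the homogeneous system of
  displacement constraints has no nonzero solution that vanishes on the anchors. The angle
  constraints involve anchors only, hence on motions \<open>\<delta>p\<close> vanishing on the anchors their rows of the
  rigidity matrix contribute nothing; there \<open>R(p) \<delta>p = f(\<delta>p)\<close>, and \<open>\<delta>p\<close> is an infinitesimal motion
  iff it solves that homogeneous system.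
\<close>

lemma node_pos_add_smult:
  assumes "x \<in> carrier_vec (3 * num_nodes N)" "y \<in> carrier_vec (3 * num_nodes N)" "i \<in> nodes N"
  shows "node_pos (x + s \<cdot>\<^sub>v y) i = node_pos x i + s *\<^sub>R node_pos y i"
  using assms by (auto simp: node_pos_def nodes_def Finite_Cartesian_Product.vec_eq_iff forall_3)

text \<open>Translates between the blockwise condition used in the lemmas below and the initial
  segment \<delta>p_a of the theorem.\<close>

lemma node_pos_anchors_eq_0_iff:
  "(\<forall>i \<in> anchors N. node_pos x i = 0) \<longleftrightarrow>
    vec_first x (3 * num_anchors N) = 0\<^sub>v (3 * num_anchors N)"
proof -
  have "(\<forall>i \<in> anchors N. node_pos x i = 0) \<longleftrightarrow> (\<forall>c < 3 * num_anchors N. x $ c = 0)"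
  proof
    assume 0: "\<forall>i \<in> anchors N. node_pos x i = 0"
    show "\<forall>c < 3 * num_anchors N. x $ c = 0"
    proof (intro allI impI)
      fix c assume c: "c < 3 * num_anchors N"
      \<comment> \<open>Node i owns the entries 3(i - 1), 3(i - 1) + 1 and 3(i - 1) + 2, so the
        0-based entry c belongs to the 1-based node c div 3 + 1.\<close>
      have "c div 3 + 1 \<in> anchors N" using c by (auto simp: anchors_def)
      then have "node_pos x (c div 3 + 1) = 0" using 0 by blast
      then have *: "x $ (3 * (c div 3)) = 0" "x $ (3 * (c div 3) + 1) = 0" "x $ (3 * (c div 3) + 2) = 0"
        by (auto simp: node_pos_def Finite_Cartesian_Product.vec_eq_iff forall_3)
      have "c = 3 * (c div 3) \<or> c = 3 * (c div 3) + 1 \<or> c = 3 * (c div 3) + 2" by presburger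
      then show "x $ c = 0" using * by metis
    qed
  next
    assume "\<forall>c < 3 * num_anchors N. x $ c = 0"
    then show "\<forall>i \<in> anchors N. node_pos x i = 0"
      by (auto simp: anchors_def node_pos_def Finite_Cartesian_Product.vec_eq_iff forall_3)
  qed
  then show ?thesis by (auto simp: vec_first_def Matrix.vec_eq_iff)
qed

lemma linear_functional_expansion:
  fixes g :: "real Matrix.vec \<Rightarrow> real"
  assumes lin: "\<And>x y s. x \<in> carrier_vec d \<Longrightarrow> y \<in> carrier_vec d \<Longrightarrow> g (x + s \<cdot>\<^sub>v y) = g x + s * g y"
    and v: "v \<in> carrier_vec d"
  shows "(\<Sum>c<d. g (unit_vec d c) * v $ c) = g v"
proof -
  \<comment> \<open>Truncations of v: passing from \<open>w k\<close> to \<open>w (Suc k)\<close>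
    adds one multiple of a unit vector, so the induction adds one summand at a time.\<close>
  define w where "w k = Matrix.vec d (\<lambda>i. if i < k then v $ i else 0)" for k
  have "k \<le> d \<Longrightarrow> (\<Sum>c<k. g (unit_vec d c) * v $ c) = g (w k)" for k
  proof (induction k)
    case 0
    \<comment> \<open>\<open>w 0\<close> is the zero vector z, and z + 1 z = z gives g z + g z = g
      z, hence g z = 0.\<close>
    have "w 0 + 1 \<cdot>\<^sub>v w 0 = w 0" by (rule eq_vecI) (auto simp: w_def)
    then show ?case using lin[of "w 0" "w 0" 1] by (simp add: w_def)
  next
    case (Suc k)
    have "w (Suc k) = w k + v $ k \<cdot>\<^sub>v unit_vec d k"
      using Suc.prems by (intro eq_vecI) (auto simp: w_def unit_vec_def less_Suc_eq)
    then have "g (w (Suc k)) = g (w k) + v $ k * g (unit_vec d k)"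
      by (simp add: lin w_def)
    then show ?case using Suc by simp
  qed
  moreover have "w d = v" using v by (intro eq_vecI) (auto simp: w_def)
  ultimately show ?thesis by auto
qed

text \<open>The components of f as a list that does not depend on x: row r of the rigidity matrix is
  then the gradient at p of the single function at index r.\<close>

definition constraint_functions :: "network \<Rightarrow> (real Matrix.vec \<Rightarrow> real) list" where
  "constraint_functions N = map (\<lambda>t x. angle_constraint N x t) (angle_list N) @
     concat (map (\<lambda>t. map (\<lambda>m x. vec_nth (disp_constraint N x t) m) [1, 2, 3]) (disp_list N))"

lemma angle_displacement_function_eq:
  "angle_displacement_function N x = vec_of_list (map (\<lambda>\<phi>. \<phi> x) (constraint_functions N))"
  by (simp add: angle_displacement_function_def constraint_functions_def map_concat comp_def)

context measurement_network
begin

lemma disp_tuple_nodes: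
  assumes "(i, j, k, h, l) \<in> disp_tuples N"
  shows "i \<in> nodes N" "j \<in> nodes N" "k \<in> nodes N" "h \<in> nodes N" "l \<in> nodes N"
  using assms disp_tuples_subset edges_subset by (auto simp: candidate_tuples_def)

lemma set_constraint_functions:
  "set (constraint_functions N) = (\<lambda>t x. angle_constraint N x t) ` angle_triples N \<union>
     (\<Union>t \<in> disp_tuples N. range (\<lambda>m x. vec_nth (disp_constraint N x t) m))"
proof -
  have "set (node_list N) = nodes N" by (auto simp: node_list_def nodes_def)
  moreover have "angle_triples N \<subseteq> nodes N \<times> nodes N \<times> nodes N"
    using anchors_le by (auto simp: angle_triples_def anchors_def nodes_def)
  moreover have "disp_tuples N \<subseteq> nodes N \<times> nodes N \<times> nodes N \<times> nodes N \<times> nodes N"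
    using disp_tuple_nodes by auto
  ultimately have "set (angle_list N) = angle_triples N" "set (disp_list N) = disp_tuples N"
    by (auto simp: angle_list_def disp_list_def Let_def)
  then show ?thesis by (auto simp: constraint_functions_def UNIV_3)
qed

text \<open>The coefficients are attached to t and not to the configuration, so the constraint is
  linear in the node positions.\<close>

lemma disp_constraint_add_smult:
  assumes "t \<in> disp_tuples N"
    and "x \<in> carrier_vec (3 * num_nodes N)" "y \<in> carrier_vec (3 * num_nodes N)"
  shows "disp_constraint N (x + s \<cdot>\<^sub>v y) t = disp_constraint N x t + s *\<^sub>R disp_constraint N y t"
proof -
  obtain i j k h l where t: "t = (i, j, k, h, l)" using prod_cases5 by blast
  note nodes = disp_tuple_nodes[OF assms(1)[unfolded t]]
  show ?thesis
    using assms(2,3) nodes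
    by (simp add: t disp_constraint_def displacement_def node_pos_add_smult algebra_simps
        split: prod.split)
qed

text \<open>The weights are computed at \<open>position N\<close> and stay fixed, so x enters only
  through the positions of three anchors.\<close>

lemma angle_constraint_cong:
  assumes "t \<in> angle_triples N" "\<And>i. i \<in> anchors N \<Longrightarrow> node_pos x i = node_pos y i"
  shows "angle_constraint N x t = angle_constraint N y t"
  using assms by (auto simp: angle_triples_def angle_constraint_def displacement_def split: prod.split)

text \<open>One row of R(p) v = f(v). A displacement component is linear, hence equal to its own
  derivative. An angle constraint is quadratic, but for v vanishing on the anchors both sides are
  0.\<close>

lemma constraint_function_derivative:
  assumes \<phi>: "\<phi> \<in> set (constraint_functions N)"
    and v: "v \<in> carrier_vec (3 * num_nodes N)" "\<forall>i \<in> anchors N. node_pos v i = 0"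
  shows "(\<Sum>c < 3 * num_nodes N.
      deriv (\<lambda>s. \<phi> (position N + s \<cdot>\<^sub>v unit_vec (3 * num_nodes N) c)) 0 * v $ c) = \<phi> v"
proof -
  let ?d = "3 * num_nodes N" and ?p = "position N"
  consider t where "t \<in> angle_triples N" "\<phi> = (\<lambda>x. angle_constraint N x t)"
    | t m where "t \<in> disp_tuples N" "\<phi> = (\<lambda>x. vec_nth (disp_constraint N x t) m)"
    using \<phi> by (auto simp: set_constraint_functions)
  then show ?thesis
  proof cases
    case (1 t)
    \<comment> \<open>Every summand vanishes: at an anchor coordinate v is 0, and moving along a
      free coordinate leaves the anchors in place, so \<phi> is constant in s.\<close>
    have "deriv (\<lambda>s. \<phi> (?p + s \<cdot>\<^sub>v unit_vec ?d c)) 0 * v $ c = 0" if c: "c < ?d" for c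
    proof (cases "c < 3 * num_anchors N")
      case True
      then have "v $ c = 0"
        using v(2) by (auto simp: node_pos_anchors_eq_0_iff vec_first_def Matrix.vec_eq_iff)
      then show ?thesis by simp
    next
      case False
      then have "\<forall>i \<in> anchors N. node_pos (unit_vec ?d c) i = 0"
        using c by (auto simp: node_pos_anchors_eq_0_iff vec_first_def Matrix.vec_eq_iff unit_vec_def)
      moreover have "i \<in> nodes N" if "i \<in> anchors N" for i
        using that anchors_le by (auto simp: anchors_def nodes_def)
      ultimately have "\<phi> (?p + s \<cdot>\<^sub>v unit_vec ?d c) = \<phi> ?p" for s
        unfolding 1 using position_dim
        by (intro angle_constraint_cong 1) (simp add: node_pos_add_smult[where N = N])
      then show ?thesis by simp
    qed
    moreover have "\<phi> v = 0"
      using 1 v(2)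
      by (auto simp: angle_triples_def angle_constraint_def displacement_def split: prod.split)
    ultimately show ?thesis by (metis (no_types, lifting) sum.neutral lessThan_iff)
  next
    case (2 t m)
    have lin: "\<phi> (x + s \<cdot>\<^sub>v y) = \<phi> x + s * \<phi> y" if "x \<in> carrier_vec ?d" "y \<in> carrier_vec ?d" for x y s
      using that by (simp add: 2 disp_constraint_add_smult)
    \<comment> \<open>By \<open>lin\<close> the function of s is affine with slope \<phi>(e_c); the
      sum is then the expansion of \<phi>(v) in the unit vectors.\<close>
    have "deriv (\<lambda>s. \<phi> (?p + s \<cdot>\<^sub>v unit_vec ?d c)) 0 = \<phi> (unit_vec ?d c)" for c
      unfolding lin[OF position_dim unit_vec_carrier]
      by (rule DERIV_imp_deriv) (auto intro!: derivative_eq_intros)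
    then show ?thesis using linear_functional_expansion[of ?d \<phi> v] lin v(1) by simp
  qed
qed

lemma rigidity_matrix_mult_vec:
  assumes "v \<in> carrier_vec (3 * num_nodes N)" "\<forall>i \<in> anchors N. node_pos v i = 0"
  shows "rigidity_matrix N *\<^sub>v v = angle_displacement_function N v"
proof (rule eq_vecI)
  let ?\<Phi> = "constraint_functions N"
  fix r assume "r < dim_vec (angle_displacement_function N v)"
  then have r: "r < length ?\<Phi>" by (simp add: angle_displacement_function_eq)
  have dim: "dim_vec (position N) = 3 * num_nodes N" "dim_vec v = 3 * num_nodes N"
    using position_dim assms(1) by auto
  have "(rigidity_matrix N *\<^sub>v v) $ r = (\<Sum>c < 3 * num_nodes N.
      deriv (\<lambda>s. (?\<Phi> ! r) (position N + s \<cdot>\<^sub>v unit_vec (3 * num_nodes N) c)) 0 * v $ c)"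
    using r by (simp add: rigidity_matrix_def jacobian_def angle_displacement_function_eq dim
        scalar_prod_def vec_of_list_index atLeast0LessThan)
  also have "\<dots> = (?\<Phi> ! r) v"
    using r assms by (intro constraint_function_derivative) auto
  finally show "(rigidity_matrix N *\<^sub>v v) $ r = angle_displacement_function N v $ r"
    using r by (simp add: angle_displacement_function_eq vec_of_list_index)
qed (simp add: rigidity_matrix_def jacobian_def angle_displacement_function_eq)

text \<open>By R(p) v = f(v), such a motion is a zero of f; the angle components of f(v) vanish by
  themselves because all displacements between anchors are 0 in v.\<close>

lemma anchor_fixing_motion_iff:
  assumes "\<forall>i \<in> anchors N. node_pos v i = 0"
  shows "infinitesimal_motion N v \<longleftrightarrow>
    v \<in> carrier_vec (3 * num_nodes N) \<and> (\<forall>t \<in> disp_tuples N. disp_constraint N v t = 0)"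
proof -
  let ?\<Phi> = "constraint_functions N"
  have dim: "dim_col (rigidity_matrix N) = 3 * num_nodes N"
    "dim_row (rigidity_matrix N) = length ?\<Phi>"
    using position_dim by (auto simp: rigidity_matrix_def jacobian_def angle_displacement_function_eq)
  have "angle_displacement_function N v = 0\<^sub>v (length ?\<Phi>) \<longleftrightarrow> (\<forall>\<phi> \<in> set ?\<Phi>. \<phi> v = 0)"
    by (auto simp: angle_displacement_function_eq Matrix.vec_eq_iff vec_of_list_index
        all_set_conv_all_nth)
  also have "\<dots> \<longleftrightarrow> (\<forall>t \<in> angle_triples N. angle_constraint N v t = 0) \<and>
      (\<forall>t \<in> disp_tuples N. disp_constraint N v t = 0)"
    by (auto simp: set_constraint_functions Finite_Cartesian_Product.vec_eq_iff ball_Un)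
  also have "\<dots> \<longleftrightarrow> (\<forall>t \<in> disp_tuples N. disp_constraint N v t = 0)"
    using assms
    by (auto simp: angle_triples_def angle_constraint_def displacement_def split: prod.split)
  finally show ?thesis
    using rigidity_matrix_mult_vec[OF _ assms]
    by (auto simp: infinitesimal_motion_def mat_kernel_def dim)
qed

text \<open>The solutions of the localization problem form the translate by p of the solution space
  of the homogeneous system, so uniqueness of p means that this space is trivial.\<close>

lemma localizable_iff:
  "localizable N \<longleftrightarrow> (\<forall>v \<in> carrier_vec (3 * num_nodes N).
     (\<forall>i \<in> anchors N. node_pos v i = 0) \<and> (\<forall>t \<in> disp_tuples N. disp_constraint N v t = 0) \<longrightarrow>
     v = 0\<^sub>v (3 * num_nodes N))"
  (is "_ \<longleftrightarrow> (\<forall>v \<in> ?C. ?hom v \<longrightarrow> v = ?z)")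
proof -
  let ?p = "position N"
  define sol where "sol q \<longleftrightarrow> (\<forall>i \<in> anchors N. node_pos q i = node_pos ?p i) \<and>
    (\<forall>t \<in> disp_tuples N. disp_constraint N q t = 0)" for q
  have anchors: "i \<in> nodes N" if "i \<in> anchors N" for i
    using that anchors_le by (auto simp: anchors_def nodes_def)
  \<comment> \<open>The factor 1 brings p + v into the shape of the two \<open>add_smult\<close>
    lemmas; p itself contributes 0 to each displacement constraint.\<close>
  have sol: "sol (?p + 1 \<cdot>\<^sub>v v) \<longleftrightarrow> ?hom v" if v: "v \<in> ?C" for v
  proof -
    have "node_pos (?p + 1 \<cdot>\<^sub>v v) i = node_pos ?p i + node_pos v i" if "i \<in> anchors N" for i
      using node_pos_add_smult[OF position_dim v anchors[OF that], of 1] by simp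
    moreover have "disp_constraint N (?p + 1 \<cdot>\<^sub>v v) t = disp_constraint N v t"
      if "t \<in> disp_tuples N" for t
      using disp_constraint_add_smult[OF that position_dim v, of 1] disp_constraint_position[OF that]
      by simp
    ultimately show ?thesis unfolding sol_def by simp
  qed
  \<comment> \<open>Since p is a solution, the set equation in \<open>localizable\<close> reduces to
    uniqueness.\<close>
  have "sol ?p" using disp_constraint_position by (simp add: sol_def)
  then have "localizable N \<longleftrightarrow> (\<forall>q \<in> ?C. sol q \<longrightarrow> q = ?p)"
    using position_dim by (auto simp: localizable_def sol_def)
  also have "\<dots> \<longleftrightarrow> (\<forall>v \<in> ?C. ?hom v \<longrightarrow> v = ?z)"
  proof (intro iffI ballI impI)
    fix v assume uniq: "\<forall>q \<in> ?C. sol q \<longrightarrow> q = ?p" and v: "v \<in> ?C" "?hom v"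
    have "?p + 1 \<cdot>\<^sub>v v = ?p" using uniq sol[OF v(1)] v position_dim by simp
    then have eq: "(?p + 1 \<cdot>\<^sub>v v) $ c = ?p $ c" for c by simp
    show "v = ?z"
    proof (rule eq_vecI)
      fix c assume "c < dim_vec ?z"
      then show "v $ c = ?z $ c" using eq[of c] v(1) by simp
    qed (use v(1) in simp)
  next
    fix q assume triv: "\<forall>v \<in> ?C. ?hom v \<longrightarrow> v = ?z" and q: "q \<in> ?C" "sol q"
    have q_eq: "q = ?p + 1 \<cdot>\<^sub>v (q - ?p)" using q(1) position_dim by (intro eq_vecI) auto
    have diff: "q - ?p \<in> ?C" using q(1) position_dim by simp
    then have "q - ?p = ?z" using triv sol q(2) q_eq by metis
    then show "q = ?p" using q_eq position_dim by simp
  qed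
  finally show ?thesis .
qed

end

theorem theorem5:
  fixes N :: network
  assumes "measurement_network N"
    and "inj_on (node_pos (position N)) (nodes N)"
    and "\<forall>i \<in> anchors N. card (neighbors N i \<inter> anchors N) \<ge> 2"
    and "\<forall>i \<in> free_nodes N. card (neighbors N i) \<ge> 4"
    and "measurement N \<in> {Relative_Bearing, Angle} \<Longrightarrow>
      \<forall>i \<in> free_nodes N. \<not> collinear (node_pos (position N) ` insert i (neighbors N i))"
  shows "localizable N \<longleftrightarrow>
    (\<forall>\<delta>p \<in> mat_kernel (information_matrix N).
       \<delta>p \<noteq> 0\<^sub>v (3 * num_nodes N) \<longrightarrow> vec_first \<delta>p (3 * num_anchors N) \<noteq> 0\<^sub>v (3 * num_anchors N))"
proof -
  interpret measurement_network N by fact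
  show ?thesis
    \<comment> \<open>By contraposition the right-hand side says that a motion with zero anchor part
      is zero; \<open>anchor_fixing_motion_iff\<close> identifies these motions with the homogeneous
      solutions.\<close>
    unfolding localizable_iff
    using anchor_fixing_motion_iff
    by (auto simp: infinitesimal_motion_iff_information_matrix node_pos_anchors_eq_0_iff)
qed

end
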